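(* Let $t,s,c,\sigma,\gamma$ be positive integers with $\gamma<c$, and let $r=r(t,s,c,\sigma,\gamma)$ be the optimal (minimum) number of dinners of the Business Dinner Problem with these parameters. Then $r\geq lb_i$ for each $i=1,\ldots,5$, where $$lb_1=\left\lceil\frac{s}{\sigma}\right\rceil,\quad lb_2=\left\lceil\frac{c}{\gamma}\right\rceil,\quad lb_3=\left\lceil\frac{s}{t\sigma}\left\lceil\frac{c}{\gamma}\right\rceil\right\rceil,$$ $$lb_4=\left\lceil\frac{\sqrt{s}}{t\gamma}\left((c-\gamma)\max\left(\sqrt{\frac{\gamma}{c-\gamma}},1\right)+\frac{\gamma}{\max\left(\sqrt{\frac{\gamma}{c-\gamma}},1\right)}\right)\right\rceil,$$ $$lb_5=\max_{j\in\{2,\ldots,\sigma\}}\left\lceil\frac{s}{t} \left(\frac 2 {j} \left\lceil\frac{c}{\gamma}\right\rceil-\frac{s-1}{j(j-1)}\right)\right\rceil.$$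
   Context: Business Dinner Problem: given positive integers $t$ (number of tables), $s$ (suppliers $S=\{1,\ldots,s\}$), $c$ (customers $C=\{1,\ldots,c\}$), $\sigma$ and $\gamma$. A schedule is a finite sequence of dinners; in each dinner, each participant (supplier or customer) sits at at most one of the $t$ tables (participants may be absent from a dinner), and each table hosts at most $\sigma$ suppliers and at most $\gamma$ customers. The schedule is feasible if (i) any two distinct suppliers sit at the same table in at most one dinner, and (ii) every customer and every supplier sit at the same table in exactly one dinner. The optimal value $r(t,s,c,\sigma,\gamma)$ is the minimum number of dinners of a feasible schedule. *)

theory Defs
  imports Complex_Main
begin

text \<open>
  The suppliers are \<open>{1..s}\<close>, the customers \<open>{1..c}\<close> and the tables \<open>{1..t}\<close>. A dinner maps every
  participant to its table. A partial map allows absences and makes it impossible to sit at two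
  tables in the same dinner.
\<close>

datatype dinner =
  Dinner (supplier_table: "nat \<rightharpoonup> nat") (customer_table: "nat \<rightharpoonup> nat")

definition suppliers_at :: "dinner \<Rightarrow> nat \<Rightarrow> nat set" where
  "suppliers_at d k = {i. supplier_table d i = Some k}"

definition customers_at :: "dinner \<Rightarrow> nat \<Rightarrow> nat set" where
  "customers_at d k = {h. customer_table d h = Some k}"

definition valid_dinner :: "nat \<Rightarrow> nat \<Rightarrow> nat \<Rightarrow> nat \<Rightarrow> nat \<Rightarrow> dinner \<Rightarrow> bool" where
  "valid_dinner t s c \<sigma> \<gamma> d \<longleftrightarrow>
     dom (supplier_table d) \<subseteq> {1..s} \<and> ran (supplier_table d) \<subseteq> {1..t} \<and>
     dom (customer_table d) \<subseteq> {1..c} \<and> ran (customer_table d) \<subseteq> {1..t} \<and>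
     (\<forall>k\<in>{1..t}. card (suppliers_at d k) \<le> \<sigma> \<and> card (customers_at d k) \<le> \<gamma>)"

definition suppliers_meet :: "dinner \<Rightarrow> nat \<Rightarrow> nat \<Rightarrow> bool" where
  "suppliers_meet d i j \<longleftrightarrow> (\<exists>k. i \<in> suppliers_at d k \<and> j \<in> suppliers_at d k)"

definition supplier_customer_meet :: "dinner \<Rightarrow> nat \<Rightarrow> nat \<Rightarrow> bool" where
  "supplier_customer_meet d i h \<longleftrightarrow> (\<exists>k. i \<in> suppliers_at d k \<and> h \<in> customers_at d k)"

definition feasible_schedule ::
  "nat \<Rightarrow> nat \<Rightarrow> nat \<Rightarrow> nat \<Rightarrow> nat \<Rightarrow> dinner list \<Rightarrow> bool" where
  "feasible_schedule t s c \<sigma> \<gamma> ds \<longleftrightarrow>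
     (\<forall>d\<in>set ds. valid_dinner t s c \<sigma> \<gamma> d) \<and>
     (\<forall>i\<in>{1..s}. \<forall>j\<in>{1..s}. i \<noteq> j \<longrightarrow>
        card {n. n < length ds \<and> suppliers_meet (ds ! n) i j} \<le> 1) \<and>
     (\<forall>i\<in>{1..s}. \<forall>h\<in>{1..c}.
        card {n. n < length ds \<and> supplier_customer_meet (ds ! n) i h} = 1)"

text \<open>
  For positive parameters the minimum is over a nonempty set: each supplier-customer pair can be
  given a dinner of its own.
\<close>

definition min_dinners :: "nat \<Rightarrow> nat \<Rightarrow> nat \<Rightarrow> nat \<Rightarrow> nat \<Rightarrow> nat" where
  "min_dinners t s c \<sigma> \<gamma> = (LEAST r. \<exists>ds. feasible_schedule t s c \<sigma> \<gamma> ds \<and> length ds = r)"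

definition lb1 :: "nat \<Rightarrow> nat \<Rightarrow> int" where
  "lb1 s \<sigma> = \<lceil>real s / real \<sigma>\<rceil>"

definition lb2 :: "nat \<Rightarrow> nat \<Rightarrow> int" where
  "lb2 c \<gamma> = \<lceil>real c / real \<gamma>\<rceil>"

definition lb3 :: "nat \<Rightarrow> nat \<Rightarrow> nat \<Rightarrow> nat \<Rightarrow> nat \<Rightarrow> int" where
  "lb3 t s c \<sigma> \<gamma> = \<lceil>real s / (real t * real \<sigma>) * real_of_int \<lceil>real c / real \<gamma>\<rceil>\<rceil>"

definition lb4 :: "nat \<Rightarrow> nat \<Rightarrow> nat \<Rightarrow> nat \<Rightarrow> int" where
  "lb4 t s c \<gamma> =
     (let m = max (sqrt (real \<gamma> / (real c - real \<gamma>))) 1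
      in \<lceil>sqrt (real s) / (real t * real \<gamma>) * ((real c - real \<gamma>) * m + real \<gamma> / m)\<rceil>)"

text \<open>
  For \<open>\<sigma> = 1\<close> the index range is empty and \<open>Max\<close> is unspecified, so \<open>lb5\<close> is only meaningful for
  \<open>\<sigma> \<ge> 2\<close>.
\<close>

definition lb5 :: "nat \<Rightarrow> nat \<Rightarrow> nat \<Rightarrow> nat \<Rightarrow> nat \<Rightarrow> int" where
  "lb5 t s c \<sigma> \<gamma> =
     Max ((\<lambda>j. \<lceil>real s / real t *
        (2 / real j * real_of_int \<lceil>real c / real \<gamma>\<rceil>
          - (real s - 1) / (real j * (real j - 1)))\<rceil>) ` {2..\<sigma>})"

end

theory Submission
  imports Defs
begin

text \<open>
  Only the incidence structure of the \<open>r t\<close> tables (over all dinners) matters. Each supplier occupies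
  at least \<open>\<lceil>c/\<gamma>\<rceil>\<close> tables, in distinct dinners, and each customer at least \<open>\<lceil>s/\<sigma>\<rceil>\<close>; this gives
  the first three bounds. For the fifth, sum \<open>(x - j)(x - j + 1) \<ge> 0\<close> over the tables, where \<open>x\<close> is the
  number of suppliers at the table, and use that distinct suppliers meet at most once.

  For the fourth, let a customer visit \<open>a\<close> of the \<open>N = r t\<close> tables. Each supplier occupies exactly one
  of these, and at least \<open>(c - \<gamma>)/\<gamma>\<close> of the others; a visited and an unvisited table share at most
  one supplier. Hence \<open>s (c - \<gamma>) \<le> \<gamma> a (N - a)\<close>, so \<open>N \<gamma> \<ge> \<gamma> a + s (c - \<gamma>)/a\<close>. If \<open>c \<le> 2 \<gamma>\<close>,
  minimise over \<open>a\<close>; otherwise choose a customer with \<open>a c \<le> N \<gamma>\<close>.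
\<close>

text \<open>\<open>B\<close> will be the set of pairs (dinner, table), with \<open>X b\<close> and
  \<open>Y b\<close> the suppliers and customers seated at \<open>b\<close>. Of the grouping into
  dinners, only what \<open>meet\<close> and \<open>pair\<close> express is kept.\<close>

locale seating =
  fixes B :: "'b set" and S :: "'a set" and C :: "'c set"
    and X :: "'b \<Rightarrow> 'a set" and Y :: "'b \<Rightarrow> 'c set" and \<sigma> \<gamma> :: nat
  assumes fin_B: "finite B" and fin_S: "finite S" and fin_C: "finite C"
    and X_sub: "\<And>b. b \<in> B \<Longrightarrow> X b \<subseteq> S" and Y_sub: "\<And>b. b \<in> B \<Longrightarrow> Y b \<subseteq> C"
    and card_X: "\<And>b. b \<in> B \<Longrightarrow> card (X b) \<le> \<sigma>" and card_Y: "\<And>b. b \<in> B \<Longrightarrow> card (Y b) \<le> \<gamma>"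
    and meet: "\<And>i h. i \<in> S \<Longrightarrow> h \<in> C \<Longrightarrow> \<exists>!b. b \<in> B \<and> i \<in> X b \<and> h \<in> Y b"
    and pair: "\<And>i j b b'. b \<in> B \<Longrightarrow> b' \<in> B \<Longrightarrow> i \<noteq> j \<Longrightarrow> i \<in> X b \<Longrightarrow> j \<in> X b \<Longrightarrow>
                i \<in> X b' \<Longrightarrow> j \<in> X b' \<Longrightarrow> b = b'"
begin

section \<open>Incidence counts for suppliers and customers\<close>

lemma finite_X: "b \<in> B \<Longrightarrow> finite (X b)"
  using X_sub fin_S finite_subset by blast

lemma finite_Y: "b \<in> B \<Longrightarrow> finite (Y b)"
  using Y_sub fin_C finite_subset by blast

lemma card_UN_bounded:
  assumes "finite A" "\<And>b. b \<in> A \<Longrightarrow> card (F b) \<le> k"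
  shows "card (\<Union>b\<in>A. F b) \<le> card A * k"
  using card_UN_le[OF assms(1), of F] sum_bounded_above[of A "\<lambda>b. card (F b)" k] assms(2)
  by fastforce

text \<open>By \<open>meet\<close>, the tables that \<open>h\<close> visits together seat every
  supplier, and each of them contributes at most \<open>\<sigma>\<close>.\<close>

lemma customer_degree:
  assumes "h \<in> C"
  shows "card S \<le> card {b \<in> B. h \<in> Y b} * \<sigma>"
proof -
  have "S \<subseteq> (\<Union>b\<in>{b \<in> B. h \<in> Y b}. X b)" using meet[OF _ assms] by blast
  then have "card S \<le> card (\<Union>b\<in>{b \<in> B. h \<in> Y b}. X b)"
    using fin_B finite_X by (intro card_mono) auto
  also have "\<dots> \<le> card {b \<in> B. h \<in> Y b} * \<sigma>"
    using fin_B card_X by (intro card_UN_bounded) auto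
  finally show ?thesis .
qed

lemma supplier_degree:
  assumes "i \<in> S"
  shows "card C \<le> card {b \<in> B. i \<in> X b} * \<gamma>"
proof -
  have "C \<subseteq> (\<Union>b\<in>{b \<in> B. i \<in> X b}. Y b)" using meet[OF assms] by blast
  then have "card C \<le> card (\<Union>b\<in>{b \<in> B. i \<in> X b}. Y b)"
    using fin_B finite_Y by (intro card_mono) auto
  also have "\<dots> \<le> card {b \<in> B. i \<in> X b} * \<gamma>"
    using fin_B card_Y by (intro card_UN_bounded) auto
  finally show ?thesis .
qed

lemma supplier_incidences: "(\<Sum>i\<in>S. card {b \<in> B. i \<in> X b}) = (\<Sum>b\<in>B. card (X b))"
proof (rule sum_multicount_gen[OF fin_S fin_B], intro ballI)
  fix b assume "b \<in> B"
  then have "{i \<in> S. i \<in> X b} = X b" using X_sub by auto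
  then show "card {i \<in> S. i \<in> X b} = card (X b)" by simp
qed

lemma customer_incidences: "(\<Sum>h\<in>C. card {b \<in> B. h \<in> Y b}) = (\<Sum>b\<in>B. card (Y b))"
proof (rule sum_multicount_gen[OF fin_C fin_B], intro ballI)
  fix b assume "b \<in> B"
  then have "{h \<in> C. h \<in> Y b} = Y b" using Y_sub by auto
  then show "card {h \<in> C. h \<in> Y b} = card (Y b)" by simp
qed

section \<open>Pairs of suppliers\<close>

lemma card_offdiag:
  assumes "finite A"
  shows "card (A \<times> A - Id_on A) = card A * (card A - 1)"
proof -
  have "Id_on A = (\<lambda>x. (x, x)) ` A" by auto
  then have "card (Id_on A) = card A" by (simp add: card_image inj_on_def)
  moreover have "card (A \<times> A - Id_on A) = card (A \<times> A) - card (Id_on A)"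
    using assms by (intro card_Diff_subset) (auto simp: Id_on_def)
  ultimately show ?thesis by (simp add: card_cartesian_product diff_mult_distrib2)
qed

text \<open>By \<open>pair\<close>, an ordered pair of distinct suppliers belongs to at most one
  table, so the off-diagonal squares of the sets \<open>X b\<close> are disjoint inside that of
  \<open>S\<close>. Ordered pairs avoid halving.\<close>

lemma supplier_pairs: "(\<Sum>b\<in>B. card (X b) * (card (X b) - 1)) \<le> card S * (card S - 1)"
proof -
  have "(\<Sum>b\<in>B. card (X b) * (card (X b) - 1)) = (\<Sum>b\<in>B. card (X b \<times> X b - Id_on (X b)))"
    by (intro sum.cong) (auto simp: card_offdiag finite_X)
  also have "\<dots> = card (\<Union>b\<in>B. X b \<times> X b - Id_on (X b))"
  proof (intro card_UN_disjoint[symmetric] ballI impI)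
    show "(X b \<times> X b - Id_on (X b)) \<inter> (X b' \<times> X b' - Id_on (X b')) = {}"
      if "b \<in> B" "b' \<in> B" "b \<noteq> b'" for b b'
      using pair[OF that(1,2)] that(3) by (auto simp: Id_on_iff)
  qed (use fin_B finite_X in auto)
  also have "\<dots> \<le> card (S \<times> S - Id_on S)"
    using fin_S X_sub by (intro card_mono) (auto simp: Id_on_def)
  finally show ?thesis by (simp add: card_offdiag fin_S)
qed

text \<open>This is the fifth bound with denominators cleared; \<open>L\<close> will be
  \<open>\<lceil>c/\<gamma>\<rceil>\<close>.\<close>

lemma supplier_incidences_quadratic:
  assumes L: "\<And>i. i \<in> S \<Longrightarrow> L \<le> int (card {b \<in> B. i \<in> X b})" and j: "1 \<le> (j::int)"
  shows "2 * (j - 1) * (int (card S) * L) - int (card S) * (int (card S) - 1)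
    \<le> int (card B) * (j * (j - 1))"
proof -
  define x where "x b = int (card (X b))" for b
  have "int (card S) * L \<le> (\<Sum>i\<in>S. int (card {b \<in> B. i \<in> X b}))"
    using sum_bounded_below[of S L "\<lambda>i. int (card {b \<in> B. i \<in> X b})"] L by simp
  also have "\<dots> = (\<Sum>b\<in>B. x b)"
    unfolding x_def of_nat_sum[symmetric] supplier_incidences ..
  finally have 1: "int (card S) * L \<le> (\<Sum>b\<in>B. x b)" .
  \<comment> \<open>The truncated \<open>n - 1\<close> is harmless at \<open>n = 0\<close>, where
    the factor \<open>n\<close> vanishes.\<close>
  have pred: "int (n * (n - 1)) = int n * (int n - 1)" for n :: nat
    by (cases n) (auto simp: algebra_simps)
  have "int (\<Sum>b\<in>B. card (X b) * (card (X b) - 1)) \<le> int (card S * (card S - 1))"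
    using supplier_pairs by (subst of_nat_le_iff)
  then have 2: "(\<Sum>b\<in>B. x b * (x b - 1)) \<le> int (card S) * (int (card S) - 1)"
    unfolding of_nat_sum pred x_def .
  have "2 * (j - 1) * x b - x b * (x b - 1) \<le> j * (j - 1)" for b
  proof -
    \<comment> \<open>A product of two consecutive integers is never negative; it vanishes exactly
      at table sizes \<open>j - 1\<close> and \<open>j\<close>.\<close>
    have "0 \<le> (x b - j) * (x b - j + 1)"
      by (cases "x b \<ge> j") (auto intro: mult_nonpos_nonpos)
    then show ?thesis by (simp add: algebra_simps)
  qed
  then have "(\<Sum>b\<in>B. 2 * (j - 1) * x b - x b * (x b - 1)) \<le> (\<Sum>b\<in>B. j * (j - 1))"
    by (intro sum_mono)
  then have "2 * (j - 1) * (\<Sum>b\<in>B. x b) - (\<Sum>b\<in>B. x b * (x b - 1)) \<le> int (card B) * (j * (j - 1))"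
    by (simp add: sum_subtractf sum_distrib_left)
  moreover have "2 * (j - 1) * (int (card S) * L) \<le> 2 * (j - 1) * (\<Sum>b\<in>B. x b)"
    using 1 j by (intro mult_left_mono) auto
  ultimately show ?thesis using 2 by linarith
qed

section \<open>The square-root bound\<close>

text \<open>Double counting of the pairs of a supplier \<open>i\<close> and a table \<open>b\<close>
  occupied by \<open>i\<close> but not visited by \<open>h\<close>. Such a pair is determined by
  \<open>b\<close> and the table where \<open>i\<close> meets \<open>h\<close>.\<close>

lemma visited_unvisited:
  assumes h: "h \<in> C"
  defines "A \<equiv> {b \<in> B. h \<in> Y b}"
  shows "card S * (card C - \<gamma>) \<le> \<gamma> * (card A * card (B - A))"
proof -
  define T where "T i = (THE b. b \<in> B \<and> i \<in> X b \<and> h \<in> Y b)" for i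
  have T: "T i \<in> B" "i \<in> X (T i)" "h \<in> Y (T i)" if "i \<in> S" for i
    using theI'[OF meet[OF that h]] unfolding T_def by auto
  have T_eq: "b = T i" if "i \<in> S" "b \<in> B" "i \<in> X b" "h \<in> Y b" for i b
    using meet[OF that(1) h] T[OF that(1)] that by blast
  define U where "U i = {b \<in> B - A. i \<in> X b}" for i
  have fin_U: "finite (U i)" for i using fin_B by (simp add: U_def)
  have unvisited: "card C - \<gamma> \<le> card (U i) * \<gamma>" if i: "i \<in> S" for i
  proof -
    \<comment> \<open>The only table visited by \<open>h\<close> that \<open>i\<close> occupies is
      \<open>T i\<close>, so all customers not seated there meet \<open>i\<close> at tables in
      \<open>U i\<close>.\<close>
    have "C \<subseteq> Y (T i) \<union> (\<Union>b\<in>U i. Y b)"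
    proof
      fix k assume "k \<in> C"
      then obtain b where b: "b \<in> B" "i \<in> X b" "k \<in> Y b" using meet[OF i] by blast
      then show "k \<in> Y (T i) \<union> (\<Union>b\<in>U i. Y b)"
        using T_eq[OF i, of b] by (cases "b \<in> A") (auto simp: A_def U_def)
    qed
    then have "card C \<le> card (Y (T i) \<union> (\<Union>b\<in>U i. Y b))"
      using T(1)[OF i] finite_Y fin_U by (intro card_mono) (auto simp: U_def)
    also have "\<dots> \<le> card (Y (T i)) + card (\<Union>b\<in>U i. Y b)" by (rule card_Un_le)
    also have "\<dots> \<le> \<gamma> + card (U i) * \<gamma>"
      using card_Y T(1)[OF i] fin_U by (intro add_mono card_UN_bounded) (auto simp: U_def)
    finally show ?thesis by simp
  qed
  have "inj_on (\<lambda>(i, b). (T i, b)) (Sigma S U)"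
  proof -
    \<comment> \<open>Distinct \<open>i\<close> and \<open>j\<close> would share both
      \<open>b\<close> and \<open>T i\<close>; these differ because only \<open>T i\<close> is
      visited by \<open>h\<close>.\<close>
    have "i = j" if "i \<in> S" "b \<in> U i" "j \<in> S" "b \<in> U j" "T i = T j" for i j b
    proof -
      have "b \<noteq> T i" "b \<in> B" "i \<in> X b" "j \<in> X b" using that T by (auto simp: U_def A_def)
      then show ?thesis
        using pair[of b "T i" i j] T[OF that(1)] T[OF that(3)] that(5) by auto
    qed
    then show ?thesis by (auto intro!: inj_onI)
  qed
  then have "card (Sigma S U) \<le> card (A \<times> (B - A))"
  proof (rule card_inj_on_le)
    show "(\<lambda>(i, b). (T i, b)) ` Sigma S U \<subseteq> A \<times> (B - A)"
      using T by (auto simp: A_def U_def)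
  qed (use fin_B in \<open>simp add: A_def\<close>)
  then have "(\<Sum>i\<in>S. card (U i)) \<le> card A * card (B - A)"
    using fin_S fin_U by (simp add: card_SigmaI card_cartesian_product)
  then have "(\<Sum>i\<in>S. card (U i) * \<gamma>) \<le> \<gamma> * (card A * card (B - A))"
    unfolding sum_distrib_right[symmetric] by simp
  moreover have "card S * (card C - \<gamma>) \<le> (\<Sum>i\<in>S. card (U i) * \<gamma>)"
    using sum_bounded_below[of S "card C - \<gamma>" "\<lambda>i. card (U i) * \<gamma>"] unvisited by simp
  ultimately show ?thesis by linarith
qed

text \<open>Averaging: the customer degrees sum to at most \<open>card B * \<gamma>\<close>, so some
  degree does not exceed the mean.\<close>

lemma exists_customer_low_degree:
  assumes "C \<noteq> {}"
  shows "\<exists>h\<in>C. card {b \<in> B. h \<in> Y b} * card C \<le> card B * \<gamma>"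
proof (rule ccontr)
  assume "\<not> ?thesis"
  then have *: "card B * \<gamma> < card {b \<in> B. h \<in> Y b} * card C" if "h \<in> C" for h
    using that by (meson not_le)
  have "(\<Sum>h\<in>C. card {b \<in> B. h \<in> Y b}) \<le> card B * \<gamma>"
    unfolding customer_incidences using sum_bounded_above[of B "\<lambda>b. card (Y b)" \<gamma>] card_Y by simp
  then have "(\<Sum>h\<in>C. card {b \<in> B. h \<in> Y b}) * card C \<le> (\<Sum>h\<in>C. card B * \<gamma>)"
    by simp
  moreover have "(\<Sum>h\<in>C. card B * \<gamma>) < (\<Sum>h\<in>C. card {b \<in> B. h \<in> Y b} * card C)"
    using * assms fin_C by (intro sum_strict_mono) auto
  ultimately show False by (simp add: sum_distrib_right)
qed

text \<open>In the notation of the proof, \<open>key\<close> says that \<open>N g\<close> is at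
  least \<open>f(a) = g a + q\<^sup>2 d / a\<close>. This \<open>f\<close> is minimal at
  \<open>q sqrt(d/g)\<close>, with value \<open>2 q sqrt(d g)\<close>, the claim when
  \<open>d \<le> g\<close>. For \<open>d > g\<close> the claim is \<open>f(q) = q (d + g)\<close>:
  below \<open>q\<close> the function decreases, and from \<open>q\<close> on the averaging bound
  \<open>ac\<close> suffices.\<close>

lemma sqrt_bound:
  assumes "0 < card S" "0 < \<gamma>" "\<gamma> < card C"
  defines "m \<equiv> max (sqrt (real \<gamma> / (real (card C) - real \<gamma>))) 1"
  shows "sqrt (real (card S)) * ((real (card C) - real \<gamma>) * m + real \<gamma> / m)
    \<le> real (card B) * real \<gamma>"
proof -
  define q where "q = sqrt (real (card S))"
  define d where "d = real (card C) - real \<gamma>"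
  define g where "g = real \<gamma>"
  define N where "N = real (card B)"
  have pos: "0 < q" "0 < d" "0 < g" using assms by (auto simp: q_def d_def g_def)
  have "C \<noteq> {}" using assms by auto
  then obtain h where h: "h \<in> C" "card {b \<in> B. h \<in> Y b} * card C \<le> card B * \<gamma>"
    using exists_customer_low_degree by blast
  define A where "A = {b \<in> B. h \<in> Y b}"
  define a where "a = real (card A)"
  have "card A \<le> card B" "card (B - A) = card B - card A"
    using fin_B by (auto simp: A_def card_mono card_Diff_subset)
  then have N_a: "real (card (B - A)) = N - a" by (simp add: N_def a_def of_nat_diff)
  have "real (card S * (card C - \<gamma>)) \<le> real (\<gamma> * (card A * card (B - A)))"
    using visited_unvisited[OF h(1)] unfolding A_def by (subst of_nat_le_iff)
  then have key: "q\<^sup>2 * d \<le> g * (a * (N - a))"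
    using assms(3) by (simp add: N_a q_def d_def g_def a_def of_nat_diff)
  have ac: "a * (d + g) \<le> N * g"
    using h(2) unfolding a_def A_def d_def g_def N_def
    by (simp flip: of_nat_mult)
  \<comment> \<open>Positivity allows both cases to prove the inequality multiplied by
    \<open>a\<close> and then cancel.\<close>
  have a: "0 < a"
  proof (rule ccontr)
    assume "\<not> 0 < a"
    then have "a = 0" by (simp add: a_def)
    then show False using key pos by (simp add: mult_le_0_iff)
  qed
  have "q * (d * m + g / m) \<le> N * g"
  proof (cases "d \<le> g")
    case True
    then have m: "m = sqrt g / sqrt d"
      using pos by (simp add: m_def d_def g_def real_sqrt_divide max_def field_simps)
    have "d * m = sqrt d * sqrt g" "g / m = sqrt d * sqrt g"
      using pos unfolding m by (simp_all add: field_simps flip: power2_eq_square)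
    then have lhs: "q * (d * m + g / m) = 2 * (q * sqrt d) * sqrt g"
      by (simp add: algebra_simps)
    \<comment> \<open>AM-GM for \<open>q\<^sup>2 d\<close> and \<open>g a\<^sup>2\<close>, whose sum
      is at most \<open>N g a\<close> by \<open>key\<close>.\<close>
    have "0 \<le> (q * sqrt d - sqrt g * a)\<^sup>2" by simp
    also have "\<dots> = q\<^sup>2 * d + g * a\<^sup>2 - (2 * (q * sqrt d) * sqrt g) * a"
      using pos by (simp add: power2_diff power_mult_distrib)
    finally have "(2 * (q * sqrt d) * sqrt g) * a \<le> (N * g) * a"
      using key by (simp add: algebra_simps power2_eq_square)
    then show ?thesis unfolding lhs using a by simp
  next
    case False
    then have m: "m = 1"
      using pos by (simp add: m_def d_def g_def max_def)
    have "q * (d + g) \<le> N * g"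
    proof (cases "q \<le> a")
      case True
      then have "q * (d + g) \<le> a * (d + g)" using pos by (intro mult_right_mono) auto
      then show ?thesis using ac by linarith
    next
      case q: False
      have "g * a \<le> d * q" using False q pos a by (intro mult_mono) auto
      \<comment> \<open>Expanded, this reads
        \<open>a q (d + g) \<le> d q\<^sup>2 + g a\<^sup>2\<close>, and \<open>key\<close> bounds
        the right side by \<open>N g a\<close>.\<close>
      then have "0 \<le> (q - a) * (d * q - g * a)" using q by simp
      then have "(q * (d + g)) * a \<le> (N * g) * a"
        using key by (simp add: algebra_simps power2_eq_square)
      then show ?thesis using a by simp
    qed
    then show ?thesis by (simp add: m)
  qed
  then show ?thesis by (simp add: q_def d_def g_def N_def)
qed

end

section \<open>From schedules to incidence structures\<close>

text \<open>Ensures that the \<open>LEAST\<close> in \<open>min_dinners\<close> is attained. Each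
  dinner seats a single pair at table 1, so no two suppliers ever meet.\<close>

lemma feasible_schedule_exists:
  assumes "0 < t" "0 < \<sigma>" "0 < \<gamma>"
  shows "\<exists>ds. feasible_schedule t s c \<sigma> \<gamma> ds"
proof -
  define ps where "ps = List.product [1..<Suc s] [1..<Suc c]"
  define D where "D = (\<lambda>(i, h). Dinner [i \<mapsto> 1] [h \<mapsto> 1])"
  have ps: "distinct ps" "set ps = {1..s} \<times> {1..c}"
    by (auto simp: ps_def distinct_product)
  have at: "suppliers_at (D (i, h)) k = (if k = 1 then {i} else {})"
    "customers_at (D (i, h)) k = (if k = 1 then {h} else {})" for i h k
    by (auto simp: D_def suppliers_at_def customers_at_def split: if_splits)
  have "valid_dinner t s c \<sigma> \<gamma> d" if d_in: "d \<in> set (map D ps)" for d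
  proof -
    obtain i h where d: "d = D (i, h)" "i \<in> {1..s}" "h \<in> {1..c}"
      using d_in ps(2) by auto
    show ?thesis using d(2,3) assms unfolding d(1) valid_dinner_def at by (auto simp: D_def)
  qed
  moreover have "\<not> suppliers_meet (map D ps ! n) i j" if "n < length ps" "i \<noteq> j" for n i j
    using that by (cases "ps ! n") (auto simp: suppliers_meet_def at split: if_splits)
  then have "{n. n < length (map D ps) \<and> suppliers_meet (map D ps ! n) i j} = {}" if "i \<noteq> j" for i j
    using that by auto
  then have "card {n. n < length (map D ps) \<and> suppliers_meet (map D ps ! n) i j} \<le> 1"
    if "i \<noteq> j" for i j
    using that by (metis card.empty zero_le)
  moreover have "card {n. n < length (map D ps) \<and> supplier_customer_meet (map D ps ! n) i h} = 1"
    if "i \<in> {1..s}" "h \<in> {1..c}" for i h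
  proof -
    have "(i, h) \<in> set ps" using that ps by auto
    then obtain n where n: "n < length ps" "ps ! n = (i, h)" by (auto simp: in_set_conv_nth)
    \<comment> \<open>Only a dinner made for the pair \<open>(i, h)\<close> lets them meet, and
      distinctness of \<open>ps\<close> leaves one such index.\<close>
    have "supplier_customer_meet (map D ps ! k) i h \<longleftrightarrow> k = n" if "k < length ps" for k
    proof -
      have "supplier_customer_meet (map D ps ! k) i h \<longleftrightarrow> ps ! k = (i, h)"
        using that by (cases "ps ! k") (auto simp: supplier_customer_meet_def at split: if_splits)
      then show ?thesis using n ps(1) that by (metis nth_eq_iff_index_eq)
    qed
    then have "{n. n < length (map D ps) \<and> supplier_customer_meet (map D ps ! n) i h} = {n}"
      using n(1) by auto
    then show ?thesis by simp
  qed
  ultimately have "feasible_schedule t s c \<sigma> \<gamma> (map D ps)"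
    unfolding feasible_schedule_def by blast
  then show ?thesis ..
qed

text \<open>Feasibility fixes the dinner of a meeting; since a supplier has at most one table per
  dinner, the pair (dinner, table) is fixed as well.\<close>

lemma seating_of_schedule:
  assumes "feasible_schedule t s c \<sigma> \<gamma> ds"
  shows "seating ({..<length ds} \<times> {1..t}) {1..s} {1..c}
    (\<lambda>(n, k). suppliers_at (ds ! n) k) (\<lambda>(n, k). customers_at (ds ! n) k) \<sigma> \<gamma>"
proof -
  have valid: "valid_dinner t s c \<sigma> \<gamma> (ds ! n)" if "n < length ds" for n
    using assms that by (auto simp: feasible_schedule_def)
  have sub: "suppliers_at (ds ! n) k \<subseteq> {1..s}" "customers_at (ds ! n) k \<subseteq> {1..c}"
    if "n < length ds" for n k
    using valid[OF that]
    unfolding valid_dinner_def suppliers_at_def customers_at_def by blast+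
  \<comment> \<open>The meeting predicates quantify over every \<open>k\<close>, so a meeting place
    must be shown to be one of the \<open>t\<close> tables.\<close>
  have table: "k \<in> {1..t}" if "n < length ds" "i \<in> suppliers_at (ds ! n) k" for n k i
    using valid[OF that(1)] that(2) unfolding valid_dinner_def suppliers_at_def
    by (auto simp: ran_def)
  have unique: "k = l" if "i \<in> suppliers_at d k" "i \<in> suppliers_at d l" for i d k l
    using that by (simp add: suppliers_at_def)
  show ?thesis
  proof
    show "\<exists>!b. b \<in> {..<length ds} \<times> {1..t} \<and> i \<in> (case b of (n, k) \<Rightarrow> suppliers_at (ds ! n) k)
        \<and> h \<in> (case b of (n, k) \<Rightarrow> customers_at (ds ! n) k)"
      if "i \<in> {1..s}" "h \<in> {1..c}" for i h
    proof -
      have "card {n. n < length ds \<and> supplier_customer_meet (ds ! n) i h} = 1"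
        using assms that by (auto simp: feasible_schedule_def)
      then obtain n where n: "{n. n < length ds \<and> supplier_customer_meet (ds ! n) i h} = {n}"
        using card_1_singletonE by blast
      then have "n < length ds" "supplier_customer_meet (ds ! n) i h" by auto
      then obtain k where k: "i \<in> suppliers_at (ds ! n) k" "h \<in> customers_at (ds ! n) k"
        by (auto simp: supplier_customer_meet_def)
      show ?thesis
      proof (rule ex1I[of _ "(n, k)"])
        fix b
        assume b: "b \<in> {..<length ds} \<times> {1..t} \<and> i \<in> (case b of (n, k) \<Rightarrow> suppliers_at (ds ! n) k)
          \<and> h \<in> (case b of (n, k) \<Rightarrow> customers_at (ds ! n) k)"
        then have "fst b \<in> {n. n < length ds \<and> supplier_customer_meet (ds ! n) i h}"
          by (auto simp: supplier_customer_meet_def)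
        then have "fst b = n" unfolding n by simp
        then show "b = (n, k)" using b k unique by (cases b) auto
      qed (use k table \<open>n < length ds\<close> in auto)
    qed
    show "b = b'"
      if b: "b \<in> {..<length ds} \<times> {1..t}" "b' \<in> {..<length ds} \<times> {1..t}" "i \<noteq> j"
        "i \<in> (case b of (n, k) \<Rightarrow> suppliers_at (ds ! n) k)"
        "j \<in> (case b of (n, k) \<Rightarrow> suppliers_at (ds ! n) k)"
        "i \<in> (case b' of (n, k) \<Rightarrow> suppliers_at (ds ! n) k)"
        "j \<in> (case b' of (n, k) \<Rightarrow> suppliers_at (ds ! n) k)" for i j b b'
    proof -
      let ?M = "{n. n < length ds \<and> suppliers_meet (ds ! n) i j}"
      have "i \<in> {1..s} \<and> j \<in> {1..s}" 
        using b(1,4,5) sub(1)[of "fst b" "snd b"] unfolding case_prod_unfold mem_Times_iff by blast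
      then have "card ?M \<le> 1" using assms \<open>i \<noteq> j\<close> by (auto simp: feasible_schedule_def)
      moreover have "fst b \<in> ?M" "fst b' \<in> ?M" using b by (auto simp: suppliers_meet_def)
      ultimately have "fst b = fst b'" using card_le_Suc0_iff_eq[of ?M] by auto
      then show ?thesis using b unique by (cases b; cases b') auto
    qed
  next
    fix b assume "b \<in> {..<length ds} \<times> {1..t}"
    then obtain n k where b: "b = (n, k)" "n < length ds" "k \<in> {1..t}" by auto
    show "(case b of (n, k) \<Rightarrow> suppliers_at (ds ! n) k) \<subseteq> {1..s}"
      "(case b of (n, k) \<Rightarrow> customers_at (ds ! n) k) \<subseteq> {1..c}"
      using sub[OF b(2)] b(1) by simp_all
    show "card (case b of (n, k) \<Rightarrow> suppliers_at (ds ! n) k) \<le> \<sigma>"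
      "card (case b of (n, k) \<Rightarrow> customers_at (ds ! n) k) \<le> \<gamma>"
      using valid[OF b(2)] b(1,3) by (simp_all add: valid_dinner_def)
  qed simp_all
qed

text \<open>With \<open>P n k\<close> read as sitting at table \<open>k\<close> in dinner
  \<open>n\<close>, a participant's tables lie in distinct dinners, so projection to the dinner is
  injective.\<close>

lemma card_graph_le:
  assumes "\<And>n k l. k \<in> K \<Longrightarrow> l \<in> K \<Longrightarrow> P n k \<Longrightarrow> P n l \<Longrightarrow> k = l"
  shows "card {b \<in> {..<r::nat} \<times> K. case b of (n, k) \<Rightarrow> P n k} \<le> r"
proof -
  have "card {b \<in> {..<r} \<times> K. case b of (n, k) \<Rightarrow> P n k} \<le> card {..<r}"
    by (rule card_inj_on_le[of fst]) (auto intro!: inj_onI dest: assms)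
  then show ?thesis by simp
qed

section \<open>The five bounds for an optimal schedule\<close>

theorem theorem1p2:
  fixes t s c \<sigma> \<gamma> r :: nat
  assumes "0 < t" and "0 < s" and "0 < c" and "0 < \<sigma>" and "0 < \<gamma>"
    and "\<gamma> < c"
    and "r = min_dinners t s c \<sigma> \<gamma>"
  shows "int r \<ge> lb1 s \<sigma> \<and> int r \<ge> lb2 c \<gamma> \<and> int r \<ge> lb3 t s c \<sigma> \<gamma> \<and>
         int r \<ge> lb4 t s c \<gamma> \<and> (\<sigma> \<ge> 2 \<longrightarrow> int r \<ge> lb5 t s c \<sigma> \<gamma>)"
proof -
  have "\<exists>ds. feasible_schedule t s c \<sigma> \<gamma> ds \<and> length ds = r"
    unfolding assms(7) min_dinners_def
    by (rule LeastI_ex) (use feasible_schedule_exists[OF assms(1,4,5)] in blast)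
  then obtain ds where ds: "feasible_schedule t s c \<sigma> \<gamma> ds" and r: "length ds = r" by blast
  define X where "X = (\<lambda>(n, k). suppliers_at (ds ! n) k)"
  define Y where "Y = (\<lambda>(n, k). customers_at (ds ! n) k)"
  define B where "B = {..<r} \<times> {1..t}"
  interpret seating B "{1..s}" "{1..c}" X Y \<sigma> \<gamma>
    using seating_of_schedule[OF ds] unfolding X_def Y_def B_def r .
  have card_B: "card B = r * t" by (simp add: B_def card_cartesian_product)
  have X_le: "card {b \<in> B. i \<in> X b} \<le> r" for i
    using card_graph_le[of "{1..t}" "\<lambda>n k. i \<in> suppliers_at (ds ! n) k" r]
    by (simp add: B_def X_def suppliers_at_def case_prod_unfold)
  have Y_le: "card {b \<in> B. h \<in> Y b} \<le> r" for h
    using card_graph_le[of "{1..t}" "\<lambda>n k. h \<in> customers_at (ds ! n) k" r]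
    by (simp add: B_def Y_def customers_at_def case_prod_unfold)
  define L where "L = \<lceil>real c / real \<gamma>\<rceil>"
  \<comment> \<open>The degree is an integer, so the bound \<open>c/\<gamma>\<close> may be rounded
    up; this produces the inner ceilings of the third and fifth bounds.\<close>
  have L_le: "L \<le> int (card {b \<in> B. i \<in> X b})" if "i \<in> {1..s}" for i
  proof -
    have "real c \<le> real (card {b \<in> B. i \<in> X b} * \<gamma>)"
      using supplier_degree[OF that] by (subst of_nat_le_iff) simp
    then show ?thesis unfolding L_def using assms(5) by (intro ceiling_le) (simp add: field_simps)
  qed
  have 1: "lb1 s \<sigma> \<le> int r"
  proof -
    have "s \<le> card {b \<in> B. 1 \<in> Y b} * \<sigma>" using customer_degree[of 1] assms(3) by simp
    also have "\<dots> \<le> r * \<sigma>" using Y_le by simp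
    finally have "real s \<le> real (r * \<sigma>)" by (subst of_nat_le_iff)
    then show ?thesis unfolding lb1_def using assms(4) by (intro ceiling_le) (simp add: field_simps)
  qed
  have 2: "lb2 c \<gamma> \<le> int r"
    using L_le[of 1] X_le[of 1] assms(2) by (simp add: lb2_def L_def)
  have 3: "lb3 t s c \<sigma> \<gamma> \<le> int r"
  proof -
    \<comment> \<open>Supplier incidences counted twice: at least \<open>L\<close> per supplier, at
      most \<open>\<sigma>\<close> per table.\<close>
    have "int s * L \<le> (\<Sum>i\<in>{1..s}. int (card {b \<in> B. i \<in> X b}))"
      using sum_bounded_below[of "{1..s}" L "\<lambda>i. int (card {b \<in> B. i \<in> X b})"] L_le by simp
    also have "\<dots> = int (\<Sum>b\<in>B. card (X b))"
      unfolding of_nat_sum[symmetric] supplier_incidences ..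
    also have "\<dots> \<le> int (r * t * \<sigma>)"
      using sum_bounded_above[of B "\<lambda>b. card (X b)" \<sigma>] card_X card_B by (subst of_nat_le_iff) simp
    finally have "real_of_int (int s * L) \<le> real_of_int (int (r * t * \<sigma>))"
      by (subst of_int_le_iff)
    then show ?thesis unfolding lb3_def L_def[symmetric] using assms(1,4)
      by (intro ceiling_le) (simp add: field_simps)
  qed
  have 4: "lb4 t s c \<gamma> \<le> int r"
  proof -
    have "sqrt (real s) * ((real c - real \<gamma>) * m + real \<gamma> / m) \<le> real r * real t * real \<gamma>"
      if "m = max (sqrt (real \<gamma> / (real c - real \<gamma>))) 1" for m
      using sqrt_bound assms(2,5,6) unfolding that by (simp add: card_B)
    then show ?thesis unfolding lb4_def Let_def using assms(1,5)
      by (intro ceiling_le) (simp add: pos_divide_le_eq mult.assoc)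
  qed
  have 5: "lb5 t s c \<sigma> \<gamma> \<le> int r" if "2 \<le> \<sigma>"
  proof -
    have "\<lceil>real s / real t * (2 / real j * real_of_int L - (real s - 1) / (real j * (real j - 1)))\<rceil>
        \<le> int r" if j: "2 \<le> j" for j :: nat
    proof (rule ceiling_le)
      have "2 * (int j - 1) * (int s * L) - int s * (int s - 1) \<le> int (r * t) * (int j * (int j - 1))"
        using supplier_incidences_quadratic[OF L_le, of "int j"] j by (simp add: card_B)
      then have "real_of_int (2 * (int j - 1) * (int s * L) - int s * (int s - 1))
          \<le> real_of_int (int (r * t) * (int j * (int j - 1)))"
        by (subst of_int_le_iff)
      then have *: "2 * (real j - 1) * (real s * real_of_int L) - real s * (real s - 1)
          \<le> real r * real t * (real j * (real j - 1))"
        by simp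
      have pos: "0 < real j" "0 < real j - 1" "0 < real t" using j assms(1) by auto
      \<comment> \<open>Over the common denominator \<open>t j (j - 1)\<close> the numerator is the
        left side of the quadratic estimate.\<close>
      have "real s / real t * (2 / real j * real_of_int L - (real s - 1) / (real j * (real j - 1)))
          = (2 * (real j - 1) * (real s * real_of_int L) - real s * (real s - 1))
            / (real t * (real j * (real j - 1)))"
        using pos by (simp add: divide_simps) (simp add: algebra_simps)
      also have "\<dots> \<le> real r"
        using * pos by (simp add: pos_divide_le_eq mult.assoc)
      finally show "real s / real t *
          (2 / real j * real_of_int L - (real s - 1) / (real j * (real j - 1)))
        \<le> real_of_int (int r)" by simp
    qed
    \<comment> \<open>\<open>2 \<le> \<sigma>\<close> makes the index set nonempty, so bounding
      \<open>Max\<close> amounts to bounding each member.\<close>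
    then show ?thesis unfolding lb5_def L_def[symmetric] using that by (subst Max_le_iff) auto
  qed
  show ?thesis using 1 2 3 4 5 by simp
qed

end
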